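(* Let $p\ge5$, $A=\mathbb Z_p^3$, $\Omega=(0,1,2)$, $\eta=1+p\Omega$, so that $\bar\eta=1$ ($P=1$) and $\omega=\bar\Omega$. For every $Q(X)=A_0+B_0X+C_0\binom X2\in\mathbb F_p[X]$ with $C_0\ne0$, there exists $\gamma\in A\setminus pA$ such that, with $x_0=\bar\gamma$: $x_0\ne0$, $\operatorname{Tr}(x_0)=0$, $\operatorname{Tr}(x_0\omega)=0$, $\operatorname{Tr}_A(\gamma)\in p^2\mathbb Z_p$, $\operatorname{Tr}_A(\gamma\Omega)\in p\mathbb Z_p$, and \[ \frac{\operatorname{Tr}_A(\gamma)}{p^2}+\frac{\operatorname{Tr}_A(\gamma\Omega)}{p}X+\operatorname{Tr}(x_0\omega^2)\binom X2\equiv Q(X)\pmod p. \] That is, the unique mod-$p$ class $a=0$ is primitive first-order singular with quadratic Hensel polynomial exactly $Q$.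
   Context: Traces of $\mathbb F_p^3/\mathbb F_p$ and $\mathbb Z_p^3/\mathbb Z_p$ are sums of coordinates. For the branch $F_0(t)=\operatorname{Tr}_A(\gamma\eta^t)$, the quadratic Hensel polynomial of a primitive first-order singular class is $A_0+B_0X+\Delta\binom X2$ with $A_0\equiv\operatorname{Tr}_A(\gamma)/p^2$, $B_0\equiv\operatorname{Tr}_A(\gamma U)/p$, $\Delta=\operatorname{Tr}(\bar\gamma\omega^2)$, where $\eta=1+pU$ (here $U=\Omega$). *)

theory Defs
  imports
    "HOL-Analysis.Cartesian_Space"
    "HOL-Computational_Algebra.Polynomial"
    "Berlekamp_Zassenhaus.Finite_Field"
begin

section \<open>The ring of p-adic integers\<close>

text \<open>
  The prime is \<open>p = CARD('p)\<close>, as for the prime field \<^typ>\<open>'p mod_ring\<close>.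
  The type below is the inverse limit of the rings of integers modulo \<open>p ^ n\<close>: an element is
  the compatible sequence of its least non-negative residues.
\<close>

typedef ('p::prime_card) padic_int =
  "{x :: nat \<Rightarrow> int. \<forall>n. x n \<in> {0..<int CARD('p) ^ n} \<and> x (Suc n) mod int CARD('p) ^ n = x n}"
  by (rule exI[of _ "\<lambda>_. 0"]) (simp add: prime_gt_0_nat[OF prime_card])

setup_lifting type_definition_padic_int

lemma card_pos: "0 < int CARD('p::prime_card)"
  by (simp add: prime_gt_0_nat[OF prime_card])

lemma mod_power_Suc_mod: "(a mod q ^ Suc n) mod q ^ n = a mod (q::int) ^ n"
  by (simp add: mod_mod_cancel)

instantiation padic_int :: (prime_card) comm_ring_1
begin

lift_definition zero_padic_int :: "'a padic_int" is "\<lambda>n. 0"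
  by (simp add: card_pos)

lift_definition one_padic_int :: "'a padic_int" is "\<lambda>n. 1 mod int CARD('a) ^ n"
  by (auto simp: card_pos mod_mod_cancel)

lift_definition plus_padic_int :: "'a padic_int \<Rightarrow> 'a padic_int \<Rightarrow> 'a padic_int"
  is "\<lambda>x y n. (x n + y n) mod int CARD('a) ^ n"
  by (simp add: card_pos mod_power_Suc_mod del: power_Suc) (metis mod_add_eq)

lift_definition minus_padic_int :: "'a padic_int \<Rightarrow> 'a padic_int \<Rightarrow> 'a padic_int"
  is "\<lambda>x y n. (x n - y n) mod int CARD('a) ^ n"
  by (simp add: card_pos mod_power_Suc_mod del: power_Suc) (metis mod_diff_eq)

lift_definition uminus_padic_int :: "'a padic_int \<Rightarrow> 'a padic_int"
  is "\<lambda>x n. (- x n) mod int CARD('a) ^ n"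
  by (simp add: card_pos mod_power_Suc_mod del: power_Suc) (metis mod_minus_eq)

lift_definition times_padic_int :: "'a padic_int \<Rightarrow> 'a padic_int \<Rightarrow> 'a padic_int"
  is "\<lambda>x y n. (x n * y n) mod int CARD('a) ^ n"
  by (simp add: card_pos mod_power_Suc_mod del: power_Suc) (metis mod_mult_eq)

instance
proof
  fix a b c :: "'a padic_int"
  show "a * b * c = a * (b * c)" by transfer (simp add: mod_simps mult.assoc)
  show "a * b = b * a" by transfer (simp add: mult.commute)
  show "1 * a = a" by transfer (simp add: mod_simps fun_eq_iff)
  show "a + b + c = a + (b + c)" by transfer (simp add: mod_simps add.assoc)
  show "a + b = b + a" by transfer (simp add: add.commute)
  show "0 + a = a" by transfer (simp add: fun_eq_iff)
  show "- a + a = 0" by transfer (simp add: mod_simps)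
  show "a - b = a + - b" by transfer (simp add: mod_simps)
  show "(a + b) * c = a * c + b * c" by transfer (simp add: mod_simps distrib_right)
  show "(0::'a padic_int) \<noteq> 1"
  proof (transfer, rule notI)
    assume "(\<lambda>n. 0) = (\<lambda>n. 1 mod int CARD('a) ^ n)"
    then have "0 = 1 mod int CARD('a) ^ 1" by (rule fun_cong)
    with prime_gt_1_nat[OF prime_card[where 'a='a]] show False by simp
  qed
qed

end

lemma Rep_padic_int_mod:
  "Rep_padic_int x (n + k) mod int CARD('p) ^ n = Rep_padic_int (x :: 'p::prime_card padic_int) n"
proof (induction k)
  case 0
  show ?case using Rep_padic_int[of x] by simp
next
  case (Suc k)
  have "Rep_padic_int x (n + Suc k) mod int CARD('p) ^ n
      = (Rep_padic_int x (n + Suc k) mod int CARD('p) ^ (n + k)) mod int CARD('p) ^ n"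
    by (simp add: mod_mod_cancel le_imp_power_dvd)
  also have "Rep_padic_int x (n + Suc k) mod int CARD('p) ^ (n + k) = Rep_padic_int x (n + k)"
    using Rep_padic_int[of x] by simp
  finally show ?case using Suc.IH by simp
qed

instance padic_int :: (prime_card) idom
proof
  fix a b :: "'a padic_int"
  let ?q = "int CARD('a)"
  assume "a \<noteq> 0" "b \<noteq> 0"
  then obtain m n where m: "Rep_padic_int a m \<noteq> 0" and n: "Rep_padic_int b n \<noteq> 0"
    by (auto simp: Rep_padic_int_inject[symmetric] zero_padic_int.rep_eq fun_eq_iff)
  have pr: "prime_elem ?q" using prime_card_int[where 'a='a] by auto
  have a: "\<not> ?q ^ m dvd Rep_padic_int a (m + n)"
    using m Rep_padic_int_mod[of a m n] by (auto simp: dvd_eq_mod_eq_0)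
  have b: "\<not> ?q ^ n dvd Rep_padic_int b (m + n)"
    using n Rep_padic_int_mod[of b n m] by (auto simp: dvd_eq_mod_eq_0 add.commute)
  have "\<not> ?q ^ (m + n) dvd Rep_padic_int a (m + n) * Rep_padic_int b (m + n)"
  proof
    assume "?q ^ (m + n) dvd Rep_padic_int a (m + n) * Rep_padic_int b (m + n)"
    moreover have "Rep_padic_int a (m + n) \<noteq> 0" "Rep_padic_int b (m + n) \<noteq> 0"
      using a b by auto
    ultimately have "m + n \<le> multiplicity ?q (Rep_padic_int a (m + n))
                          + multiplicity ?q (Rep_padic_int b (m + n))"
      using pr by (metis mult_eq_0_iff prime_elem_multiplicity_mult_distrib
          power_dvd_iff_le_multiplicity prime_elem_not_unit)
    then have "m \<le> multiplicity ?q (Rep_padic_int a (m + n))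
             \<or> n \<le> multiplicity ?q (Rep_padic_int b (m + n))" by linarith
    with a b show False by (meson multiplicity_dvd')
  qed
  then have "Rep_padic_int (a * b) (m + n) \<noteq> 0"
    by (simp add: times_padic_int.rep_eq dvd_eq_mod_eq_0)
  then show "a * b \<noteq> 0" by (auto simp: zero_padic_int.rep_eq)
qed

text \<open>
  Exact division; the quotient is unique because the ring is a domain.
  Non-exact quotients are set to 0.
\<close>

instantiation padic_int :: (prime_card) idom_divide
begin

definition divide_padic_int :: "'a padic_int \<Rightarrow> 'a padic_int \<Rightarrow> 'a padic_int" where
  "(x :: 'a padic_int) div y = (if y \<noteq> 0 \<and> y dvd x then THE z. x = z * y else 0)"

instance
proof
  fix a b :: "'a padic_int"
  assume "b \<noteq> 0"
  then show "a * b div b = a" by (auto simp: divide_padic_int_def)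
qed (simp add: divide_padic_int_def)

end

definition padic_reduce :: "'p::prime_card padic_int \<Rightarrow> 'p mod_ring" where
  "padic_reduce x = of_int (Rep_padic_int x 1)"


section \<open>The split cubic algebras\<close>

text \<open>
  The type \<open>'a ^ 3\<close> carries the componentwise ring structure, so it is the split cubic algebra
  over \<open>'a\<close>, with \<open>1 = (1,1,1)\<close>.
\<close>

definition Tr :: "'a::comm_monoid_add ^ 3 \<Rightarrow> 'a" where
  "Tr v = (\<Sum>i\<in>UNIV. v $ i)"

definition vec_reduce :: "'p::prime_card padic_int ^ 3 \<Rightarrow> 'p mod_ring ^ 3" where
  "vec_reduce v = (\<chi> i. padic_reduce (v $ i))"

definition residual_period :: "'p::prime_card padic_int ^ 3 \<Rightarrow> nat" where
  "residual_period \<eta> = (LEAST n. 0 < n \<and> vec_reduce \<eta> ^ n = 1)"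


section \<open>Singular classes and quadratic Hensel polynomials\<close>

text \<open>
  \<open>binom_poly a b c\<close> is the polynomial \<open>a + b X + c X (X - 1) / 2\<close>.
  (The library's generalised binomial coefficient is confined to characteristic 0.)
\<close>

definition binom_poly :: "'a::field \<Rightarrow> 'a \<Rightarrow> 'a \<Rightarrow> 'a poly" where
  "binom_poly a b c = [:a:] + smult b [:0, 1:] + smult c (smult (1 / 2) ([:0, 1:] * [:- 1, 1:]))"

text \<open>
  In the following two definitions \<open>\<gamma>\<close> and \<open>U\<close> describe the branch
  \<open>t \<mapsto> Tr (\<gamma> * (1 + p * U) ^ t)\<close>.
\<close>

definition primitive_first_order_singular ::
    "'p::prime_card padic_int ^ 3 \<Rightarrow> 'p padic_int ^ 3 \<Rightarrow> bool" where
  "primitive_first_order_singular \<gamma> U \<longleftrightarrow>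
     vec_reduce \<gamma> \<noteq> 0 \<and> Tr (vec_reduce \<gamma>) = 0 \<and> Tr (vec_reduce \<gamma> * vec_reduce U) = 0"

definition quadratic_hensel_poly ::
    "'p::prime_card padic_int ^ 3 \<Rightarrow> 'p padic_int ^ 3 \<Rightarrow> 'p mod_ring poly" where
  "quadratic_hensel_poly \<gamma> U =
     binom_poly (padic_reduce (Tr \<gamma> div of_nat CARD('p) ^ 2))
                (padic_reduce (Tr (\<gamma> * U) div of_nat CARD('p)))
                (Tr (vec_reduce \<gamma> * vec_reduce U ^ 2))"

end

theory Submission
  imports Defs
begin

text \<open>The traces of \<gamma>, \<gamma>\<Omega> and \<gamma>\<Omega>^2 depend on the
  coordinates of \<gamma> through the Vandermonde matrix at the nodes 0, 1, 2. Its determinant 2 is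
  a unit because p is odd, so the three traces can be prescribed independently. The first two are
  made exactly p^2 a and p b, where a and b lift the given coefficients; modulo p this leaves
  \<gamma> = c (1, -2, 1), a second difference, whose pairing with \<Omega>^2 is 2c. Taking c to
  lift half the leading coefficient gives Q. The lemmas make \<open>padic_reduce\<close> a
  surjective ring homomorphism and let division by p cancel.\<close>

lemma of_int_mod_card_mod_ring:
  "(of_int (a mod int CARD('p)) :: 'p::prime_card mod_ring) = of_int a"
  using of_int_mod_CHAR[where 'a="'p mod_ring"] by simp

lemma padic_reduce_0 [simp]: "padic_reduce (0 :: 'p::prime_card padic_int) = 0"
  by (simp add: padic_reduce_def zero_padic_int.rep_eq)

lemma padic_reduce_1 [simp]: "padic_reduce (1 :: 'p::prime_card padic_int) = 1"
  using prime_gt_1_nat[OF prime_card[where 'a='p]]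
  by (simp add: padic_reduce_def one_padic_int.rep_eq)

text \<open>Level 1 of a p-adic sum is the sum of the level 1 residues modulo p, and this final
  residue is invisible in characteristic p.\<close>

lemma padic_reduce_add [simp]:
  "padic_reduce (x + y) = padic_reduce x + padic_reduce (y :: 'p::prime_card padic_int)"
  by (simp add: padic_reduce_def plus_padic_int.rep_eq of_int_mod_card_mod_ring)

lemma padic_reduce_diff [simp]:
  "padic_reduce (x - y) = padic_reduce x - padic_reduce (y :: 'p::prime_card padic_int)"
  by (simp add: padic_reduce_def minus_padic_int.rep_eq of_int_mod_card_mod_ring)

lemma padic_reduce_mult [simp]:
  "padic_reduce (x * y) = padic_reduce x * padic_reduce (y :: 'p::prime_card padic_int)"
  by (simp add: padic_reduce_def times_padic_int.rep_eq of_int_mod_card_mod_ring)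

lemma padic_reduce_of_nat [simp]:
  "padic_reduce (of_nat n :: 'p::prime_card padic_int) = of_nat n"
  by (induction n) simp_all

lemma padic_reduce_numeral [simp]:
  "padic_reduce (numeral k :: 'p::prime_card padic_int) = numeral k"
  using padic_reduce_of_nat[of "numeral k"] by simp

lemma padic_reduce_surj: obtains a :: "'p::prime_card padic_int" where "padic_reduce a = c"
  using surj_of_nat_mod_ring[of c] padic_reduce_of_nat by metis

text \<open>Level 2 is the first to detect this, since p vanishes modulo p but not modulo p^2. It
  lets exact division by p and p^2 cancel.\<close>

lemma of_nat_card_padic_int_nonzero: "(of_nat CARD('p) :: 'p::prime_card padic_int) \<noteq> 0"
proof
  let ?q = "CARD('p)"
  have rep: "Rep_padic_int (of_nat n :: 'p padic_int) k = int n mod int ?q ^ k" for n k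
    by (induction n)
      (simp_all add: zero_padic_int.rep_eq one_padic_int.rep_eq plus_padic_int.rep_eq mod_simps)
  assume "(of_nat ?q :: 'p padic_int) = 0"
  then have "int ?q mod int ?q ^ 2 = 0"
    using rep[of ?q 2] by (simp add: zero_padic_int.rep_eq)
  moreover have "1 < int ?q"
    using prime_gt_1_nat[OF prime_card[where 'a='p]] by simp
  ultimately show False
    by (simp add: power2_eq_square)
qed

lemma two_mod_ring_nonzero:
  assumes "2 < CARD('p)"
  shows "(2 :: 'p::prime_card mod_ring) \<noteq> 0"
proof
  assume "(2 :: 'p mod_ring) = 0"
  then have "CARD('p) dvd 2"
    by (intro of_nat_0_mod_ring_dvd) simp
  with assms show False
    by (auto dest: dvd_imp_le)
qed

lemma of_nat_vec_nth: "(of_nat n :: 'a::semiring_1 ^ 'n) $ i = of_nat n"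
  by (induction n) simp_all

text \<open>The contrapositive turns a nonzero reduction of \<gamma> into \<gamma> lying outside
  pA.\<close>

lemma vec_reduce_eq_0_if_card_dvd:
  assumes "of_nat CARD('p) dvd (v :: 'p::prime_card padic_int ^ 3)"
  shows "vec_reduce v = 0"
  using assms by (auto simp: vec_reduce_def vec_eq_iff of_nat_vec_nth elim!: dvdE)

theorem theorem3p26:
  fixes \<Omega> \<eta> :: "'p::prime_card padic_int ^ 3"
    and \<omega> :: "'p mod_ring ^ 3"
    and A\<^sub>0 B\<^sub>0 C\<^sub>0 :: "'p mod_ring"
    and Q :: "'p mod_ring poly"
  assumes "5 \<le> CARD('p)"
    and "\<Omega> = vector [0, 1, 2]"
    and "\<eta> = 1 + of_nat CARD('p) * \<Omega>"
    and "\<omega> = vec_reduce \<Omega>"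
    and "Q = binom_poly A\<^sub>0 B\<^sub>0 C\<^sub>0"
    and "C\<^sub>0 \<noteq> 0"
  shows "vec_reduce \<eta> = 1 \<and> residual_period \<eta> = 1 \<and>
    (\<exists>\<gamma> x\<^sub>0.
       \<not> of_nat CARD('p) dvd \<gamma> \<and>
       x\<^sub>0 = vec_reduce \<gamma> \<and>
       x\<^sub>0 \<noteq> 0 \<and>
       Tr x\<^sub>0 = 0 \<and>
       Tr (x\<^sub>0 * \<omega>) = 0 \<and>
       of_nat CARD('p) ^ 2 dvd Tr \<gamma> \<and>
       of_nat CARD('p) dvd Tr (\<gamma> * \<Omega>) \<and>
       binom_poly (padic_reduce (Tr \<gamma> div of_nat CARD('p) ^ 2))
                  (padic_reduce (Tr (\<gamma> * \<Omega>) div of_nat CARD('p)))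
                  (Tr (x\<^sub>0 * \<omega> ^ 2)) = Q \<and>
       primitive_first_order_singular \<gamma> \<Omega> \<and>
       quadratic_hensel_poly \<gamma> \<Omega> = Q)"
proof -
  let ?p = "of_nat CARD('p) :: 'p padic_int"
  \<comment> \<open>In coordinates, the trace claims become identities in a, b, c.\<close>
  note [simp] = of_nat_vec_nth of_nat_card_padic_int_nonzero
    vec_reduce_def vec_eq_iff Tr_def sum_3 forall_3 power2_eq_square
  have \<eta>: "vec_reduce \<eta> = 1"
    using assms(3) by simp
  then have period: "residual_period \<eta> = 1"
    unfolding residual_period_def by (intro Least_equality) auto
  have two: "(2 :: 'p mod_ring) \<noteq> 0"
    using assms(1) by (intro two_mod_ring_nonzero) simp
  obtain a b c :: "'p padic_int"
    where a: "padic_reduce a = A\<^sub>0" and b: "padic_reduce b = B\<^sub>0" and c: "padic_reduce c = C\<^sub>0 / 2"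
    by (meson padic_reduce_surj)
  \<comment> \<open>\<open>\<gamma>\<close> solves \<open>Tr \<gamma> = p\<^sup>2 a\<close>, \<open>Tr (\<gamma> \<Omega>) = p b\<close> with free third coordinate \<open>c\<close>;
    then \<open>Tr (\<gamma> \<Omega>\<^sup>2) \<equiv> 2 c\<close> modulo \<open>p\<close>.\<close>
  define \<gamma> :: "'p padic_int ^ 3"
    where "\<gamma> = vector [?p ^ 2 * a - ?p * b + c, ?p * b - 2 * c, c]"
  have \<Omega>_nth [simp]: "\<Omega> $ 1 = 0" "\<Omega> $ 2 = 1" "\<Omega> $ 3 = 2"
    using assms(2) by (simp_all add: vector_3)
  have \<gamma>_nth [simp]: "\<gamma> $ 1 = ?p ^ 2 * a - ?p * b + c" "\<gamma> $ 2 = ?p * b - 2 * c" "\<gamma> $ 3 = c"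
    unfolding \<gamma>_def by (simp_all only: vector_3)
  have Tr_\<gamma>: "Tr \<gamma> = a * ?p ^ 2" and Tr_\<gamma>\<Omega>: "Tr (\<gamma> * \<Omega>) = b * ?p"
    by (simp_all add: algebra_simps)
  have div_a: "Tr \<gamma> div ?p ^ 2 = a"
    unfolding Tr_\<gamma> by (rule nonzero_mult_div_cancel_right) simp
  have div_b: "Tr (\<gamma> * \<Omega>) div ?p = b"
    unfolding Tr_\<gamma>\<Omega> by (rule nonzero_mult_div_cancel_right) simp
  \<comment> \<open>The third coordinate reduces to \<open>C\<^sub>0 / 2\<close>, which is
    nonzero.\<close>
  have x0: "vec_reduce \<gamma> \<noteq> 0"
    using c two assms(6) by auto
  \<comment> \<open>The vector (1, -2, 1) is orthogonal to (1, 1, 1) and (0, 1, 2).\<close>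
  have tr0: "Tr (vec_reduce \<gamma>) = 0" and tr1: "Tr (vec_reduce \<gamma> * vec_reduce \<Omega>) = 0"
    by simp_all
  have "Tr (vec_reduce \<gamma> * vec_reduce \<Omega> ^ 2) = 2 * padic_reduce c"
    by simp
  also have "\<dots> = C\<^sub>0"
    using c two by (simp add: mult.commute)
  finally have tr2: "Tr (vec_reduce \<gamma> * vec_reduce \<Omega> ^ 2) = C\<^sub>0" .
  have hensel: "quadratic_hensel_poly \<gamma> \<Omega> = Q"
    unfolding quadratic_hensel_poly_def div_a div_b tr2 a b assms(5) ..
  show ?thesis
  proof (intro conjI exI)
    show "\<not> of_nat CARD('p) dvd \<gamma>"
      using x0 vec_reduce_eq_0_if_card_dvd by blast
    show "of_nat CARD('p) ^ 2 dvd Tr \<gamma>" "of_nat CARD('p) dvd Tr (\<gamma> * \<Omega>)"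
      unfolding Tr_\<gamma> Tr_\<gamma>\<Omega> by (rule dvd_triv_right)+
    show "primitive_first_order_singular \<gamma> \<Omega>"
      unfolding primitive_first_order_singular_def using x0 tr0 tr1 by blast
  qed (fact \<eta> period refl x0 tr0 tr1[folded assms(4)] hensel
      hensel[unfolded quadratic_hensel_poly_def, folded assms(4)])+
qed

end
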